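(* A connected graph $G$ of order $n \geq 3$ satisfies $e_{cc}(G) = n-1$ if and only if $G \in \{K_3, P_3, C_{(n-1),1}\}$.
   Context: $C_{(n-1),1}$ denotes the connected unicyclic graph on $n$ vertices consisting of a cycle of order $n-1$ with one pendant vertex attached to a vertex of the cycle. Cycle convexity: for $S\subseteq V(G)$, a vertex $v\notin S$ is in the cycle interval of $S$ if $G[S\cup\{v\}]$ contains a cycle through $v$; $S$ is cycle convex if no vertex outside $S$ is in its cycle interval; $\langle S\rangle_{cc}$ is the smallest cycle convex set containing $S$. A nonempty set $S\subseteq V(G)$ is $E$-independent if $|S|=1$ or there exist $p\in S$ and $p'\in \langle S\setminus\{p\}\rangle_{cc}\setminus \bigcup_{a\in S\setminus\{p\}}\langle S\setminus\{a\}\rangle_{cc}$. The exchange number $e_{cc}(G)$ is the maximum cardinality of an $E$-independent set of $G$. *)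

theory Defs
  imports "Graph_Theory.Graph_Theory"
begin

text \<open>
  Finite simple graphs are modelled by \<^locale>\<open>pair_graph\<close>: finite, loop-free, symmetric
  digraphs without parallel arcs, an edge \<open>uv\<close> being the pair of arcs \<open>(u, v)\<close>, \<open>(v, u)\<close>.
\<close>

text \<open>
  The predicate \<^const>\<open>pre_digraph.cycle\<close> also accepts the closed walk \<open>u, v, u\<close> along a single
  edge, so the cycles of the underlying simple graph are those of length at least three.
\<close>

definition cycle_through :: "('a, 'b) pre_digraph \<Rightarrow> 'a \<Rightarrow> bool" where
  "cycle_through H v \<longleftrightarrow>
    (\<exists>p. pre_digraph.cycle H p \<and> 3 \<le> length p \<and> v \<in> tail H ` set p)"

definition cycle_interval :: "('a, 'b) pre_digraph \<Rightarrow> 'a set \<Rightarrow> 'a set" where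
  "cycle_interval G S = {v \<in> verts G - S. cycle_through (G \<restriction> (S \<union> {v})) v}"

definition cycle_convex :: "('a, 'b) pre_digraph \<Rightarrow> 'a set \<Rightarrow> bool" where
  "cycle_convex G S \<longleftrightarrow> S \<subseteq> verts G \<and> cycle_interval G S = {}"

definition cycle_hull :: "('a, 'b) pre_digraph \<Rightarrow> 'a set \<Rightarrow> 'a set" where
  "cycle_hull G S = \<Inter> {C. cycle_convex G C \<and> S \<subseteq> C}"

lemma cycle_through_mono:
  assumes "cycle_through (G \<restriction> A) v" "A \<subseteq> B"
  shows "cycle_through (G \<restriction> B) v"
proof -
  have *: "compatible (G \<restriction> A) (G \<restriction> B)"
    by (simp add: compatible_def)
  show ?thesis
    using assms compatible_cas[OF *] compatible_awalk_verts[OF *]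
    unfolding cycle_through_def pre_digraph.cycle_def pre_digraph.awalk_def
    by (fastforce simp: subset_iff)
qed

lemma cycle_convex_cycle_hull:
  assumes "S \<subseteq> verts G"
  shows "cycle_convex G (cycle_hull G S)"
proof -
  have V: "cycle_convex G (verts G)"
    by (auto simp: cycle_convex_def cycle_interval_def)
  then have sub: "cycle_hull G S \<subseteq> verts G"
    using assms by (auto simp: cycle_hull_def)
  have "v \<notin> cycle_interval G (cycle_hull G S)" for v
  proof
    assume v: "v \<in> cycle_interval G (cycle_hull G S)"
    then obtain C where C: "cycle_convex G C" "S \<subseteq> C" "v \<notin> C"
      by (auto simp: cycle_interval_def cycle_hull_def)
    then have "cycle_hull G S \<union> {v} \<subseteq> C \<union> {v}"
      by (auto simp: cycle_hull_def)
    with v C show False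
      using cycle_through_mono[of G "cycle_hull G S \<union> {v}" v "C \<union> {v}"]
      by (auto simp: cycle_interval_def cycle_convex_def)
  qed
  with sub show ?thesis by (auto simp: cycle_convex_def)
qed

lemma cycle_hull_superset: "S \<subseteq> cycle_hull G S"
  by (auto simp: cycle_hull_def)

lemma cycle_hull_least: "cycle_convex G C \<Longrightarrow> S \<subseteq> C \<Longrightarrow> cycle_hull G S \<subseteq> C"
  by (auto simp: cycle_hull_def)

definition E_independent :: "('a, 'b) pre_digraph \<Rightarrow> 'a set \<Rightarrow> bool" where
  "E_independent G S \<longleftrightarrow> S \<noteq> {} \<and> S \<subseteq> verts G \<and>
    (card S = 1 \<or>
     (\<exists>p\<in>S. \<exists>p'. p' \<in> cycle_hull G (S - {p}) - (\<Union>a\<in>S - {p}. cycle_hull G (S - {a}))))"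

definition exchange_number :: "('a, 'b) pre_digraph \<Rightarrow> nat" where
  "exchange_number G = Max (card ` {S. E_independent G S})"

definition path_graph :: "nat \<Rightarrow> nat pair_pre_digraph" where
  "path_graph n = \<lparr> pverts = {..<n}, parcs = {(i, Suc i) | i. Suc i < n}\<^sup>s \<rparr>"

text \<open>The cycle \<open>0, 1, \<dots>, m - 1\<close> together with a pendant vertex \<open>m\<close> attached to \<open>0\<close>.\<close>

definition cycle_pendant_graph :: "nat \<Rightarrow> nat pair_pre_digraph" where
  "cycle_pendant_graph m =
    \<lparr> pverts = {..m}, parcs = ({(i, Suc i mod m) | i. i < m} \<union> {(0, m)})\<^sup>s \<rparr>"

lemma sym_symcl: "sym (R\<^sup>s)"
  by (force simp: symcl_def sym_def)

lemma pair_graph_path_graph: "pair_graph (path_graph n)"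
proof unfold_locales
  have "parcs (path_graph n) \<subseteq> {..<n} \<times> {..<n}"
    by (auto simp: path_graph_def symcl_def)
  then show "finite (parcs (path_graph n))"
    by (rule finite_subset) simp
  show "symmetric (with_proj (path_graph n))"
    by (simp add: symmetric_def path_graph_def sym_symcl)
qed (auto simp: path_graph_def symcl_def)

lemma pair_graph_cycle_pendant_graph:
  assumes "2 \<le> m"
  shows "pair_graph (cycle_pendant_graph m)"
proof unfold_locales
  have "parcs (cycle_pendant_graph m) \<subseteq> {..m} \<times> {..m}"
    using assms by (auto simp: cycle_pendant_graph_def symcl_def mod_Suc)
  then show "finite (parcs (cycle_pendant_graph m))"
    by (rule finite_subset) simp
  show "symmetric (with_proj (cycle_pendant_graph m))"
    by (simp add: symmetric_def cycle_pendant_graph_def sym_symcl)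
qed (use assms in \<open>auto simp: cycle_pendant_graph_def symcl_def mod_Suc split: if_splits\<close>)

definition is_path_graph :: "nat \<Rightarrow> ('a, 'b) pre_digraph \<Rightarrow> bool" where
  "is_path_graph n G \<longleftrightarrow> digraph_iso G (with_proj (path_graph n))"

definition is_cycle_pendant_graph :: "nat \<Rightarrow> ('a, 'b) pre_digraph \<Rightarrow> bool" where
  "is_cycle_pendant_graph m G \<longleftrightarrow> 3 \<le> m \<and> digraph_iso G (with_proj (cycle_pendant_graph m))"

end

theory Submission
  imports Defs
begin

text \<open>
  If \<open>S\<close> is \<open>E\<close>-independent with at least three elements, then the vertex \<open>p'\<close> witnessing it lies
  outside \<open>S\<close>; so for \<open>n \<ge> 4\<close> a set \<open>S\<close> of size \<open>n - 1\<close> is \<open>V - {p'}\<close>. A cycle avoiding \<open>p'\<close> or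
  some \<open>a \<noteq> p\<close> would put \<open>p'\<close> into the hull of \<open>S - {a}\<close> for some \<open>a \<noteq> p\<close>. Hence every cycle covers
  \<open>V - {p}\<close>, and \<open>p' \<in> \<langle>S - {p}\<rangle>\<close> forces a cycle on exactly \<open>V - {p}\<close>. A chord of this cycle or a
  second neighbour of \<open>p\<close> would create a cycle that is too short, so the graph is a cycle with the
  pendant vertex \<open>p\<close>.
\<close>

section \<open>Cycles as vertex lists\<close>

text \<open>The base vertex \<open>v\<close> is kept apart because convexity asks whether the rest
  \<open>xs\<close> lies in the set. Length at least two for \<open>xs\<close> rules out the closed
  walk along a single edge.\<close>

definition vertex_cycle :: "'a rel \<Rightarrow> 'a \<Rightarrow> 'a list \<Rightarrow> bool" where
  "vertex_cycle E v xs \<longleftrightarrow>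
    distinct (v # xs) \<and> 2 \<le> length xs \<and> successively (\<lambda>x y. (x, y) \<in> E) (v # xs @ [v])"

text \<open>Cutting the closed walk at \<open>w\<close> and swapping the two pieces gives the same
  cycle based at \<open>w\<close>, so any vertex of a cycle may serve as base.\<close>

lemma vertex_cycle_rotate:
  assumes "vertex_cycle E v xs" "w \<in> set (v # xs)"
  obtains ys where "vertex_cycle E w ys" "set (w # ys) = set (v # xs)"
proof (cases "w = v")
  case True
  with assms that show ?thesis by blast
next
  case False
  then obtain as bs where xs: "xs = as @ w # bs"
    using assms(2) by (auto dest: split_list)
  have "successively (\<lambda>x y. (x, y) \<in> E) ((v # as) @ w # bs @ [v])"
    using assms(1) by (simp add: vertex_cycle_def xs)
  then have "successively (\<lambda>x y. (x, y) \<in> E) ((w # bs) @ (v # as) @ [w])"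
    by (auto simp: successively_append_iff successively_Cons hd_append split: if_splits)
  then have "vertex_cycle E w (bs @ v # as)"
    using assms(1) by (auto simp: vertex_cycle_def xs)
  then show ?thesis
    by (rule that) (auto simp: xs)
qed

text \<open>The conjunct on \<open>hd\<close> strengthens the induction: it links a new first arc to
  the walk after it.\<close>

lemma successively_if_pcas:
  assumes "pcas u p v" "set p \<subseteq> E"
  shows "successively (\<lambda>x y. (x, y) \<in> E) (map fst p @ [v]) \<and> hd (map fst p @ [v]) = u"
  using assms by (induction p arbitrary: u) (fastforce simp: successively_Cons)+

lemma pcas_zip_tl:
  assumes "successively (\<lambda>x y. (x, y) \<in> E) (u # xs)"
  shows "pcas u (zip (u # xs) xs) (last (u # xs)) \<and> set (zip (u # xs) xs) \<subseteq> E"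
  using assms by (induction xs arbitrary: u) auto

lemma cas_induce_subgraph_with_proj:
  "pre_digraph.cas (with_proj G \<restriction> A) u p v \<longleftrightarrow> pcas u p v"
  by (induction p arbitrary: u) (simp_all add: pre_digraph.cas.simps)

text \<open>The tails of the arcs of a directed cycle form a vertex cycle, which is rotated to start
  at \<open>v\<close>. Conversely, pairing every vertex with its successor recovers the
  arcs.\<close>

lemma cycle_through_induce_subgraph_iff:
  "cycle_through (with_proj G \<restriction> A) v \<longleftrightarrow>
    (\<exists>xs. vertex_cycle (parcs G) v xs \<and> set (v # xs) \<subseteq> A)" (is "?L \<longleftrightarrow> ?R")
proof
  assume ?L
  then obtain p u where p': "set p \<subseteq> {e \<in> parcs G. fst e \<in> A \<and> snd e \<in> A}"
      and p: "pcas u p u" "3 \<le> length p" "v \<in> fst ` set p"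
      and dist: "distinct (tl (pre_digraph.awalk_verts (with_proj G \<restriction> A) u p))"
    by (auto simp: cycle_through_def pre_digraph.cycle_def pre_digraph.awalk_def
      cas_induce_subgraph_with_proj)
  have succ: "successively (\<lambda>x y. (x, y) \<in> parcs G) (map fst p @ [u])" "hd (map fst p @ [u]) = u"
    using successively_if_pcas[OF p(1), of "parcs G"] p' by auto
  obtain e es where pe: "p = e # es" "es \<noteq> []"
    using p(2) by (cases p; cases "tl p") auto
  have "fst e = u" "pcas (snd e) es u"
    using p(1) by (simp_all add: pe(1))
  \<comment> \<open>\<open>awalk_verts\<close> ends with the head of the last arc, which has to be
    identified with the start \<open>u\<close>.\<close>
  moreover have "snd (last es) = w" if "pcas x es w" for x w
    using that pe(2) by (induction es arbitrary: x) auto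
  ultimately have "vertex_cycle (parcs G) u (map fst es)"
    using succ dist p(2) pe
    by (auto simp: vertex_cycle_def pre_digraph.awalk_verts_conv pre_digraph.awalk_verts.simps)
  moreover have "v \<in> set (u # map fst es)"
    using p(3) \<open>fst e = u\<close> by (auto simp: pe(1))
  ultimately obtain ys where "vertex_cycle (parcs G) v ys" "set (v # ys) = set (u # map fst es)"
    by (rule vertex_cycle_rotate)
  moreover have "set (u # map fst es) \<subseteq> A"
    using p' \<open>fst e = u\<close> by (auto simp: pe(1))
  ultimately show ?R by metis
next
  assume ?R
  then obtain xs where xs: "vertex_cycle (parcs G) v xs" "set (v # xs) \<subseteq> A"
    by blast
  define p where "p = zip (v # xs @ [v]) (xs @ [v])"
  have p: "pcas v p v" "set p \<subseteq> parcs G"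
    using pcas_zip_tl[of "parcs G" v "xs @ [v]"] xs(1) by (auto simp: p_def vertex_cycle_def)
  have fst: "map fst p = v # xs"
    by (simp add: p_def map_fst_zip_take)
  have snd: "map snd p = xs @ [v]"
    by (simp add: p_def map_snd_zip_take)
  have A: "set p \<subseteq> A \<times> A"
  proof
    fix e assume "e \<in> set p"
    then have "fst e \<in> set (map fst p)" "snd e \<in> set (map snd p)" by simp_all
    then show "e \<in> A \<times> A"
      unfolding fst snd using xs(2) by (cases e) auto
  qed
  have "p \<noteq> []" using fst by auto
  have "snd (last p) = v"
    using snd \<open>p \<noteq> []\<close> by (metis last_map last_snoc)
  then have "pre_digraph.awalk_verts (with_proj G \<restriction> A) v p = v # xs @ [v]"
    using \<open>p \<noteq> []\<close> fst by (simp add: pre_digraph.awalk_verts_conv)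
  moreover have "length p = Suc (length xs)"
    using fst by (metis length_Cons length_map)
  moreover have "v \<in> fst ` set p"
    using fst by (metis list.set_intros(1) list.set_map)
  ultimately show ?L
    unfolding cycle_through_def pre_digraph.cycle_def pre_digraph.awalk_def
    using p A xs \<open>p \<noteq> []\<close>
    by (intro exI[of _ p] conjI exI[of _ v])
      (auto simp: cas_induce_subgraph_with_proj vertex_cycle_def)
qed

section \<open>Convexity and hulls through vertex lists\<close>

text \<open>\<open>v\<close> does not recur in \<open>xs\<close>, so a cycle inside
  \<open>C \<union> {v}\<close> is one with \<open>xs\<close> inside \<open>C\<close>.\<close>

lemma cycle_convex_iff:
  "cycle_convex (with_proj G) C \<longleftrightarrow> C \<subseteq> pverts G \<and>
    (\<forall>v xs. v \<in> pverts G - C \<longrightarrow> vertex_cycle (parcs G) v xs \<longrightarrow> \<not> set xs \<subseteq> C)"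
proof -
  have "set (v # xs) \<subseteq> C \<union> {v} \<longleftrightarrow> set xs \<subseteq> C" if "vertex_cycle (parcs G) v xs" for v xs
    using that by (auto simp: vertex_cycle_def)
  then show ?thesis
    unfolding cycle_convex_def cycle_interval_def cycle_through_induce_subgraph_iff by auto
qed

lemma cycle_hull_vertex_cycleI:
  assumes "vertex_cycle (parcs G) v xs" "set xs \<subseteq> cycle_hull (with_proj G) S"
    "S \<subseteq> pverts G" "v \<in> pverts G"
  shows "v \<in> cycle_hull (with_proj G) S"
  using cycle_convex_cycle_hull[of S "with_proj G"] assms by (auto simp: cycle_convex_iff)

lemma cycle_hull_mono: "S \<subseteq> T \<Longrightarrow> cycle_hull G S \<subseteq> cycle_hull G T"
  by (auto simp: cycle_hull_def)

lemma cycle_hull_convex: "cycle_convex G C \<Longrightarrow> cycle_hull G C = C"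
  by (auto simp: cycle_hull_def)

section \<open>Isomorphism and connectedness in terms of arcs\<close>

text \<open>Arcs are pairs of vertices, so the vertex part of an isomorphism determines its arc
  part. The bijection goes from \<open>H\<close> to \<open>G\<close>, so that a concrete numbered
  \<open>H\<close> labels the vertices of \<open>G\<close>.\<close>

lemma digraph_iso_with_proj_iff:
  assumes "pair_wf_digraph G" "pair_wf_digraph H"
  shows "digraph_iso (with_proj G) (with_proj H) \<longleftrightarrow>
    (\<exists>g. bij_betw g (pverts H) (pverts G) \<and>
      (\<forall>i\<in>pverts H. \<forall>j\<in>pverts H. (g i, g j) \<in> parcs G \<longleftrightarrow> (i, j) \<in> parcs H))" (is "?L \<longleftrightarrow> ?R")
proof
  interpret G: pair_wf_digraph G by fact
  interpret H: pair_wf_digraph H by fact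
  {
    assume ?L
    then obtain h where h: "pre_digraph.digraph_isomorphism (with_proj G) h"
        and H: "with_proj H = app_iso h (with_proj G)"
      by (auto simp: digraph_iso_def)
    let ?f = "iso_verts h"
    have inj: "inj_on ?f (pverts G)"
      and arc: "\<And>a. a \<in> parcs G \<Longrightarrow> ?f (fst a) = iso_tail h (iso_arcs h a) \<and>
        ?f (snd a) = iso_head h (iso_arcs h a)"
      using h by (auto simp: pre_digraph.digraph_isomorphism_def)
    have vH: "pverts H = ?f ` pverts G" and aH: "parcs H = iso_arcs h ` parcs G"
      and "iso_tail h = fst" "iso_head h = snd"
      using arg_cong[OF H, of verts] arg_cong[OF H, of arcs] arg_cong[OF H, of tail]
        arg_cong[OF H, of head]
      by (simp_all add: verts_app_iso arcs_app_iso tail_app_iso head_app_iso)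
    then have arc': "iso_arcs h a = (?f (fst a), ?f (snd a))" if "a \<in> parcs G" for a
      using arc[OF that] by (simp add: prod_eq_iff)
    have bij: "bij_betw ?f (pverts G) (pverts H)"
      using inj vH by (simp add: bij_betw_def)
    have iff: "(x, y) \<in> parcs G \<longleftrightarrow> (?f x, ?f y) \<in> parcs H" if "x \<in> pverts G" "y \<in> pverts G" for x y
    proof
      assume "(x, y) \<in> parcs G"
      then show "(?f x, ?f y) \<in> parcs H" using arc' aH by force
    next
      assume "(?f x, ?f y) \<in> parcs H"
      then obtain a where "a \<in> parcs G" "(?f x, ?f y) = (?f (fst a), ?f (snd a))"
        using arc' aH by force
      moreover from this have "fst a \<in> pverts G" "snd a \<in> pverts G"
        by (auto simp: G.arc_fst_in_verts G.arc_snd_in_verts)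
      ultimately show "(x, y) \<in> parcs G"
        using inj that by (metis Pair_inject inj_onD prod.collapse)
    qed
    show ?R
      using bij bij_betw_inv_into[OF bij]
      by (intro exI[of _ "inv_into (pverts G) ?f"])
        (auto simp: iff bij_betw_inv_into_right vH inv_into_into f_inv_into_f)
  }
  {
    assume ?R
    then obtain g where g: "bij_betw g (pverts H) (pverts G)"
        and iff: "\<And>i j. i \<in> pverts H \<Longrightarrow> j \<in> pverts H \<Longrightarrow> (g i, g j) \<in> parcs G \<longleftrightarrow> (i, j) \<in> parcs H"
      by blast
    \<comment> \<open>An isomorphism maps \<open>G\<close> to \<open>H\<close>, hence the
      inverse.\<close>
    define f where "f = inv_into (pverts H) g"
    have f: "bij_betw f (pverts G) (pverts H)"
      unfolding f_def using g by (rule bij_betw_inv_into)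
    have gf: "g (f x) = x" if "x \<in> pverts G" for x
      using g that unfolding f_def by (rule bij_betw_inv_into_right)
    have fg: "f (g x) = x" if "x \<in> pverts H" for x
      using g that unfolding f_def by (rule bij_betw_inv_into_left)
    have "(f x, f y) \<in> parcs H" if "(x, y) \<in> parcs G" for x y
      using iff[of "f x" "f y"] G.in_arcsD1[OF that] G.in_arcsD2[OF that] that gf
        bij_betwE[OF f] by auto
    moreover have "(i, j) \<in> map_prod f f ` parcs G" if "(i, j) \<in> parcs H" for i j
      using iff[of i j] H.in_arcsD1[OF that] H.in_arcsD2[OF that] that fg
      by (intro image_eqI[of _ _ "(g i, g j)"]) auto
    ultimately have arcs: "map_prod f f ` parcs G = parcs H" by auto
    have inj: "inj_on f (pverts G)" "f ` pverts G = pverts H"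
      using f by (auto simp: bij_betw_def)
    moreover have "inj_on (map_prod f f) (parcs G)"
      using map_prod_inj_on[OF inj(1) inj(1)]
      by (rule inj_on_subset) (auto simp: G.in_arcsD1 G.in_arcsD2)
    moreover have "wf_digraph (with_proj G)" by unfold_locales
    ultimately show ?L
      unfolding digraph_iso_def pre_digraph.digraph_isomorphism_def
      by (intro exI[of _ "\<lparr>iso_verts = f, iso_arcs = map_prod f f, iso_head = snd, iso_tail = fst\<rparr>"])
        (auto simp: app_iso_def with_proj_def arcs)
  }
qed

text \<open>A walk from \<open>u\<close> to \<open>v\<close> must leave \<open>X\<close> somewhere.
  As \<open>G\<close> is symmetric, the symmetric closure in the definition of connectedness changes
  nothing about reachability.\<close>

lemma (in pair_graph) connected_cut_arc:
  assumes "connected (with_proj G)" "X \<subseteq> pverts G" "u \<in> X" "v \<in> pverts G" "v \<notin> X"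
  obtains x y where "x \<in> X" "y \<in> pverts G - X" "(x, y) \<in> parcs G"
proof -
  have "u \<rightarrow>\<^sup>*\<^bsub>mk_symmetric (with_proj G)\<^esub> v"
    using assms by (auto simp: connected_def strongly_connected_def mk_symmetric_def)
  then have "u \<rightarrow>\<^sup>*\<^bsub>with_proj G\<^esub> v"
    using reachable_mk_symmetric_eq[OF sym_arcs] by simp
  then have "v \<in> X \<or> (\<exists>x\<in>X. \<exists>y\<in>pverts G - X. (x, y) \<in> parcs G)"
    using assms(3)
  proof (induction rule: reachable_induct)
    case base
    then show ?case by blast
  next
    case (step x y)
    then show ?case using in_arcsD2 by (metis DiffI)
  qed
  then show ?thesis using assms(5) that by blast
qed

section \<open>Building and traversing cycles\<close>

text \<open>\<open>v\<close> closes the segment \<open>c i, ..., c j\<close> into a cycle;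
  \<open>i < j\<close> provides the two further vertices. Later \<open>v\<close> is an end of a
  chord, the pendant vertex, or the image of vertex 0 of the model.\<close>

lemma vertex_cycle_map_upt:
  assumes "i < j" "inj_on c {i..j}" "v \<notin> c ` {i..j}" "\<And>k. i \<le> k \<Longrightarrow> k < j \<Longrightarrow> (c k, c (Suc k)) \<in> E"
    and "(v, c i) \<in> E" "(c j, v) \<in> E"
  shows "vertex_cycle E v (map c [i..<Suc j])"
proof -
  have "successively (\<lambda>x y. (x, y) \<in> E) (map c [i..<Suc j])"
    using less_imp_le[OF assms(1)] assms(4)
  proof (induction j rule: dec_induct)
    case base
    then show ?case by simp
  next
    case (step k)
    have "successively (\<lambda>x y. (x, y) \<in> E) (map c [i..<Suc k] @ [c (Suc k)])"
      unfolding successively_append_iff using step by simp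
    then show ?case using step.hyps by simp
  qed
  moreover have "hd (map c [i..<Suc j]) = c i"
    using assms(1) by (simp add: hd_map del: upt_Suc)
  moreover have "last (map c [i..<Suc j]) = c j"
    using assms(1) by simp
  ultimately have "successively (\<lambda>x y. (x, y) \<in> E) (v # map c [i..<Suc j] @ [v])"
    using assms(1,5,6) by (simp add: successively_Cons successively_append_iff del: upt_Suc)
  moreover have "{i..<Suc j} = {i..j}" by auto
  ultimately show ?thesis
    using assms(1-3) by (simp add: vertex_cycle_def distinct_map del: upt_Suc)
qed

text \<open>In the cycle based at \<open>x\<close>, the first and the last of the other vertices are
  the neighbours; they differ because there are at least two.\<close>

lemma vertex_cycle_two_neighbours:
  assumes "vertex_cycle E v xs" "x \<in> set (v # xs)" "sym E"
  obtains y z where "y \<in> set (v # xs)" "z \<in> set (v # xs)" "y \<noteq> z" "(x, y) \<in> E" "(x, z) \<in> E"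
proof -
  obtain ys where ys: "vertex_cycle E x ys" "set (x # ys) = set (v # xs)"
    using vertex_cycle_rotate[OF assms(1,2)] by blast
  obtain y zs z where "ys = y # zs @ [z]"
    using ys(1) by (cases ys; cases "tl ys" rule: rev_cases) (auto simp: vertex_cycle_def)
  with ys(1) have "y \<noteq> z" "(x, y) \<in> E" "(z, x) \<in> E"
    by (auto simp: vertex_cycle_def successively_Cons successively_append_iff)
  moreover have "y \<in> set (v # xs)" "z \<in> set (v # xs)"
    unfolding ys(2)[symmetric] using \<open>ys = y # zs @ [z]\<close> by simp_all
  ultimately show ?thesis using that assms(3) by (meson symD)
qed

text \<open>Appending \<open>hd cs\<close> accounts for the wrap-around: the last index has
  successor 0 modulo the length.\<close>

lemma successively_snoc_nth_mod:
  assumes "successively P (cs @ [hd cs])" "k < length cs"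
  shows "P (cs ! k) (cs ! (Suc k mod length cs))"
proof -
  have "P (xs ! i) (xs ! Suc i)" if "successively P xs" "Suc i < length xs" for xs i
    using that by (induction xs arbitrary: i) (auto simp: successively_Cons nth_Cons hd_conv_nth split: nat.splits)
  from this[OF assms(1), of k] have "P (cs ! k) ((cs @ [hd cs]) ! Suc k)"
    using assms(2) by (simp add: nth_append)
  moreover have "hd cs = cs ! 0"
    using assms(2) by (intro hd_conv_nth) auto
  ultimately show ?thesis
    using assms(2) by (cases "Suc k = length cs") (auto simp: nth_append)
qed

lemma parcs_cycle_pendant_graph_iff:
  assumes "i \<le> m" "j \<le> m" "2 \<le> m"
  shows "(i, j) \<in> parcs (cycle_pendant_graph m) \<longleftrightarrow>
    (i < m \<and> j < m \<and> (j = Suc i mod m \<or> i = Suc j mod m)) \<or> (i = 0 \<and> j = m) \<or> (i = m \<and> j = 0)"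
  using assms by (auto simp: cycle_pendant_graph_def symcl_def)

section \<open>E-independent sets and the exchange number\<close>

context pair_graph
begin

lemma sym_parcs: "sym (parcs G)"
  using sym_arcs by (simp add: symmetric_def)

lemma irrefl_parcs: "(x, x) \<notin> parcs G"
  using pair_no_loops[of "(x, x)"] by auto

text \<open>\<open>vertex_cycle\<close> mentions arcs only, but each vertex of a cycle is the tail
  of an arc.\<close>

lemma vertex_cycle_subset_pverts:
  assumes "vertex_cycle (parcs G) v xs"
  shows "set (v # xs) \<subseteq> pverts G"
  using vertex_cycle_two_neighbours[OF assms _ sym_parcs] by (metis in_arcsD1 subsetI)

lemma cycle_convex_singleton:
  assumes "x \<in> pverts G"
  shows "cycle_convex (with_proj G) {x}"
  unfolding cycle_convex_iff
proof (intro conjI allI impI notI)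
  fix v xs assume "vertex_cycle (parcs G) v xs" "set xs \<subseteq> {x}"
  then have "distinct xs" "2 \<le> length xs" "card (set xs) \<le> 1"
    using card_mono[of "{x}" "set xs"] by (auto simp: vertex_cycle_def)
  then show False using distinct_card[of xs] by simp
qed (use assms in auto)

text \<open>Take \<open>p = x\<close> and \<open>p' = y\<close>: singletons are convex, so
  \<open>y\<close> is in the hull of \<open>{y}\<close> but not in that of
  \<open>{x}\<close>.\<close>

lemma E_independent_pair:
  assumes "x \<in> pverts G" "y \<in> pverts G" "x \<noteq> y"
  shows "E_independent (with_proj G) {x, y}"
proof -
  have "{x, y} - {x} = {y}" "{x, y} - {y} = {x}" using assms(3) by auto
  then have "y \<in> cycle_hull (with_proj G) ({x, y} - {x})
      - (\<Union>a\<in>{x, y} - {x}. cycle_hull (with_proj G) ({x, y} - {a}))"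
    using assms cycle_hull_convex[OF cycle_convex_singleton] by simp
  then show ?thesis
    using assms unfolding E_independent_def by auto
qed

text \<open>If \<open>q\<close> were in \<open>S\<close>, an element \<open>a\<close> other than
  \<open>p\<close> and \<open>q\<close> would leave \<open>q\<close> in \<open>S - {a}\<close>,
  hence in its hull. Three elements guarantee such an \<open>a\<close>.\<close>

lemma E_independent_obtain:
  assumes "E_independent (with_proj G) S" "3 \<le> card S"
  obtains p q where "p \<in> S" "q \<in> pverts G - S" "q \<in> cycle_hull (with_proj G) (S - {p})"
    "\<And>a. a \<in> S - {p} \<Longrightarrow> q \<notin> cycle_hull (with_proj G) (S - {a})"
proof -
  obtain p q where pq: "p \<in> S" "q \<in> cycle_hull (with_proj G) (S - {p})"
      "\<And>a. a \<in> S - {p} \<Longrightarrow> q \<notin> cycle_hull (with_proj G) (S - {a})" and S: "S \<subseteq> pverts G"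
    using assms by (auto simp: E_independent_def)
  have "q \<in> pverts G"
    using cycle_convex_cycle_hull[of "S - {p}" "with_proj G"] pq(2) S
    by (auto simp: cycle_convex_def)
  moreover have "q \<notin> S"
  proof
    assume "q \<in> S"
    have "\<not> S \<subseteq> {p, q}"
      using assms(2) card_mono[of "{p, q}" S] card_insert_le_m1[of 2 "{q}" p] by auto
    then obtain a where "a \<in> S - {p}" "a \<noteq> q" by blast
    then show False
      using pq(3)[of a] cycle_hull_superset[of "S - {a}" "with_proj G"] \<open>q \<in> S\<close> by auto
  qed
  ultimately show ?thesis using that pq by blast
qed

text \<open>With three or more elements in \<open>S\<close>, the witness \<open>q\<close> outside
  \<open>S\<close> makes it a proper subset.\<close>

lemma E_independent_card_less:
  assumes "E_independent (with_proj G) S" "3 \<le> card (pverts G)"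
  shows "card S < card (pverts G)"
proof (cases "3 \<le> card S")
  case True
  then obtain q where "q \<in> pverts G - S"
    using E_independent_obtain[OF assms(1)] by metis
  then have "S \<subset> pverts G"
    using assms(1) by (auto simp: E_independent_def)
  then show ?thesis
    using pair_finite_verts by (rule psubset_card_mono[rotated])
qed (use assms(2) in simp)

lemma exchange_number_eq_iff:
  assumes "3 \<le> card (pverts G)"
  shows "exchange_number (with_proj G) = card (pverts G) - 1 \<longleftrightarrow>
    (\<exists>S. E_independent (with_proj G) S \<and> card S = card (pverts G) - 1)" (is "?L \<longleftrightarrow> ?R")
proof -
  let ?I = "{S. E_independent (with_proj G) S}"
  have "?I \<subseteq> Pow (pverts G)"
    by (auto simp: E_independent_def)
  then have fin: "finite (card ` ?I)"
    using pair_finite_verts by (meson finite_Pow_iff finite_imageI finite_subset)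
  \<comment> \<open>A singleton makes the set under \<open>Max\<close> nonempty.\<close>
  obtain x where "x \<in> pverts G" using assms by fastforce
  then have "E_independent (with_proj G) {x}" by (simp add: E_independent_def)
  then have ne: "card ` ?I \<noteq> {}" by blast
  have "k \<le> card (pverts G) - 1" if "k \<in> card ` ?I" for k
    using that E_independent_card_less[OF _ assms] by fastforce
  then have "Max (card ` ?I) = card (pverts G) - 1 \<longleftrightarrow> card (pverts G) - 1 \<in> card ` ?I"
    using Max_in[OF fin ne] Max_eqI[OF fin] by metis
  then show ?thesis by (auto simp: exchange_number_def image_iff)
qed

text \<open>Here \<open>p\<close> is the vertex removed from the \<open>E\<close>-independent set, and any vertex of the cycle on
  the remaining vertices can serve as the exchanged vertex \<open>p'\<close> outside of it.\<close>

lemma E_independent_card_pred_iff: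
  assumes "4 \<le> card (pverts G)"
  shows "(\<exists>S. E_independent (with_proj G) S \<and> card S = card (pverts G) - 1) \<longleftrightarrow>
    (\<exists>p\<in>pverts G. (\<forall>v xs. vertex_cycle (parcs G) v xs \<longrightarrow> pverts G - {p} \<subseteq> set (v # xs)) \<and>
      (\<exists>v xs. vertex_cycle (parcs G) v xs \<and> set (v # xs) = pverts G - {p}))" (is "?L \<longleftrightarrow> ?R")
proof
  let ?V = "pverts G" and ?hull = "cycle_hull (with_proj G)"
  assume ?L
  then obtain S where S: "E_independent (with_proj G) S" "card S = card ?V - 1" by blast
  moreover have "3 \<le> card S" using S assms by simp
  ultimately obtain p q where p: "p \<in> S" and q: "q \<in> ?V - S"
      and hull: "q \<in> ?hull (S - {p})" "\<And>a. a \<in> S - {p} \<Longrightarrow> q \<notin> ?hull (S - {a})"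
    using E_independent_obtain by blast
  have sub: "S \<subseteq> ?V" using S(1) by (simp add: E_independent_def)
  have SV: "S = ?V - {q}"
    using q sub S(2) pair_finite_verts by (intro card_subset_eq) auto
  have qS: "q \<in> ?hull S"
    using hull(1) cycle_hull_mono[of "S - {p}" S] by blast
  \<comment> \<open>A cycle avoiding \<open>q\<close> lies in \<open>S\<close>. Remove from it some
    \<open>a\<close> other than \<open>p\<close>: the cycle puts \<open>a\<close> back, so the hull
    of \<open>S - {a}\<close> contains that of \<open>S\<close>, and with it
    \<open>q\<close>.\<close>
  have through_q: "q \<in> set (v # xs)" if cyc: "vertex_cycle (parcs G) v xs" for v xs
  proof (rule ccontr)
    assume nq: "q \<notin> set (v # xs)"
    obtain y z where "y \<in> set (v # xs)" "z \<in> set (v # xs)" "y \<noteq> z"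
      using vertex_cycle_two_neighbours[OF cyc _ sym_parcs, of v] by (metis list.set_intros(1))
    then obtain a where a: "a \<in> set (v # xs)" "a \<noteq> p" by metis
    obtain ys where ys: "vertex_cycle (parcs G) a ys" "set (a # ys) = set (v # xs)"
      using vertex_cycle_rotate[OF cyc a(1)] by blast
    have "q \<notin> set (a # ys)" "a \<notin> set ys"
      using nq ys by (simp_all add: vertex_cycle_def)
    then have "a \<in> S" "set ys \<subseteq> S - {a}"
      using vertex_cycle_subset_pverts[OF ys(1)] by (auto simp: SV)
    then have "a \<in> ?hull (S - {a})"
      using ys(1) sub cycle_hull_superset[of "S - {a}" "with_proj G"]
      by (intro cycle_hull_vertex_cycleI[OF ys(1)]) auto
    then have "S \<subseteq> ?hull (S - {a})"
      using cycle_hull_superset[of "S - {a}" "with_proj G"] by auto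
    then have "?hull S \<subseteq> ?hull (S - {a})"
      using cycle_convex_cycle_hull[of "S - {a}" "with_proj G"] sub
      by (intro cycle_hull_least) auto
    then show False using hull(2)[of a] \<open>a \<in> S\<close> a(2) qS by auto
  qed
  \<comment> \<open>A cycle missing some \<open>a\<close> other than \<open>p\<close>, based at
    \<open>q\<close>, has its other vertices in \<open>S - {a}\<close> and so puts \<open>q\<close>
    into that hull.\<close>
  have all: "?V - {p} \<subseteq> set (v # xs)" if cyc: "vertex_cycle (parcs G) v xs" for v xs
  proof
    fix a assume a: "a \<in> ?V - {p}"
    show "a \<in> set (v # xs)"
    proof (rule ccontr)
      assume na: "a \<notin> set (v # xs)"
      obtain ys where ys: "vertex_cycle (parcs G) q ys" "set (q # ys) = set (v # xs)"
        using vertex_cycle_rotate[OF cyc through_q[OF cyc]] by blast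
      have "set ys \<subseteq> ?V - {q}"
        using vertex_cycle_subset_pverts[OF ys(1)] ys(1) by (auto simp: vertex_cycle_def)
      moreover have "a \<notin> set ys" "a \<noteq> q" using na ys(2) by auto
      ultimately have "set ys \<subseteq> S - {a}" "a \<in> S - {p}" using a SV by auto
      then have "q \<in> ?hull (S - {a})"
        using q sub cycle_hull_superset[of "S - {a}" "with_proj G"]
        by (intro cycle_hull_vertex_cycleI[OF ys(1)]) auto
      then show False using hull(2) \<open>a \<in> S - {p}\<close> by blast
    qed
  qed
  \<comment> \<open>Otherwise \<open>S - {p}\<close> would equal its hull, which contains
    \<open>q\<close>. The violating cycle passes through \<open>q\<close>, which can only be its
    base.\<close>
  have "\<not> cycle_convex (with_proj G) (S - {p})"
    using hull(1) q cycle_hull_convex by auto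
  then obtain v xs where v: "v \<in> ?V - (S - {p})" "vertex_cycle (parcs G) v xs" "set xs \<subseteq> S - {p}"
    using sub by (auto simp: cycle_convex_iff)
  have "v = q"
    using through_q[OF v(2)] v(3) q by auto
  then have "p \<notin> set (v # xs)" using v(3) p q by auto
  then have "set (v # xs) = ?V - {p}"
    using all[OF v(2)] vertex_cycle_subset_pverts[OF v(2)] by auto
  then show ?R using v(2) all p sub by blast
next
  let ?V = "pverts G" and ?hull = "cycle_hull (with_proj G)"
  assume ?R
  then obtain p q xs where p: "p \<in> ?V" and q: "vertex_cycle (parcs G) q xs" "set (q # xs) = ?V - {p}"
      and all: "\<And>v xs. vertex_cycle (parcs G) v xs \<Longrightarrow> ?V - {p} \<subseteq> set (v # xs)"
    by blast
  define S where "S = ?V - {q}"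
  have q': "q \<in> ?V" "q \<noteq> p" "set xs = S - {p}"
    using q by (auto simp: S_def vertex_cycle_def)
  then have pS: "p \<in> S" using p by (simp add: S_def)
  have "q \<in> ?hull (S - {p})"
    using cycle_hull_superset[of "S - {p}" "with_proj G"] q'
    by (intro cycle_hull_vertex_cycleI[OF q(1)]) (auto simp: S_def)
  moreover have "q \<notin> ?hull (S - {a})" if a: "a \<in> S - {p}" for a
  proof -
    \<comment> \<open>\<open>S - {a}\<close> misses both \<open>a\<close> and \<open>q\<close>,
      which every cycle contains; one added vertex \<open>v\<close> cannot supply both.\<close>
    have "cycle_convex (with_proj G) (S - {a})"
      unfolding cycle_convex_iff
    proof (intro conjI allI impI notI)
      fix v ys assume "vertex_cycle (parcs G) v ys" "set ys \<subseteq> S - {a}"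
      then have "?V - {p} \<subseteq> insert v (?V - {a, q})"
        using all[of v ys] by (auto simp: S_def)
      then show False using a q'(1,2) by (auto simp: S_def)
    qed (auto simp: S_def)
    then show ?thesis by (simp add: cycle_hull_convex S_def)
  qed
  ultimately have "E_independent (with_proj G) S"
    unfolding E_independent_def using pS by (auto simp: S_def)
  moreover have "card S = card ?V - 1"
    using q'(1) by (simp add: S_def)
  ultimately show ?L by blast
qed

section \<open>The cycle with a pendant vertex\<close>

text \<open>Connectedness gives \<open>p\<close> a neighbour on the cycle, and the cycle is numbered
  from there. Any further edge would close a segment into a cycle too short to cover
  \<open>pverts G - {p}\<close>.\<close>

lemma cycle_pendant_if_all_cycles_cover:
  assumes "connected (with_proj G)" and p: "p \<in> pverts G"
    and all: "\<And>v xs. vertex_cycle (parcs G) v xs \<Longrightarrow> pverts G - {p} \<subseteq> set (v # xs)"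
    and cyc: "vertex_cycle (parcs G) v xs" "set (v # xs) = pverts G - {p}"
  shows "is_cycle_pendant_graph (card (pverts G) - 1) (with_proj G)"
proof -
  let ?V = "pverts G" and ?E = "parcs G"
  obtain x w where "x \<in> ?V - {p}" "w \<in> ?V - (?V - {p})" "(x, w) \<in> ?E"
    using connected_cut_arc[OF assms(1), of "?V - {p}" v p] cyc(2) p by auto
  then have w: "x \<in> set (v # xs)" "(x, p) \<in> ?E" using cyc(2) by auto
  obtain ys where ys: "vertex_cycle ?E x ys" "set (x # ys) = ?V - {p}"
    using vertex_cycle_rotate[OF cyc(1) w(1)] cyc(2) by metis
  define cs where "cs = x # ys"
  define m where "m = length cs"
  have cs: "distinct cs" "set cs = ?V - {p}" "3 \<le> m" "cs ! 0 = x"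
    using ys by (auto simp: cs_def m_def vertex_cycle_def)
  have "card (?V - {p}) = m"
    using distinct_card[OF cs(1)] cs(2) m_def by simp
  then have mV: "card ?V - 1 = m" using p by simp
  \<comment> \<open>Indices are taken modulo \<open>m\<close>, so \<open>c m = c 0\<close> and
    segments may end there.\<close>
  define c where "c k = cs ! (k mod m)" for k
  have succ: "successively (\<lambda>x y. (x, y) \<in> ?E) (cs @ [hd cs])"
    using ys(1) by (simp add: cs_def vertex_cycle_def)
  have c_edge: "(c k, c (Suc k)) \<in> ?E" for k
    using successively_snoc_nth_mod[OF succ, of "k mod m"] cs(3)
    by (simp add: c_def mod_Suc_eq flip: m_def)
  have mod_lt: "k mod m < length cs" for k
  proof -
    have "k mod m < m" using cs(3) by simp
    then show ?thesis by (simp only: m_def)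
  qed
  have c_ne_p: "c k \<noteq> p" for k
    using nth_mem[OF mod_lt[of k]] cs(2) by (metis DiffE c_def singletonI)
  \<comment> \<open>Among at most \<open>m\<close> consecutive indices no two are congruent modulo
    \<open>m\<close>.\<close>
  have c_inj: "inj_on c {i..j}" if "j < i + m" for i j
  proof (rule linorder_inj_onI)
    fix k l assume kl: "k < l" "k \<in> {i..j}" "l \<in> {i..j}"
    show "c k \<noteq> c l"
    proof
      assume "c k = c l"
      then have "k mod m = l mod m"
        unfolding c_def using nth_eq_iff_index_eq[OF cs(1) mod_lt mod_lt] by blast
      then have "m dvd l - k" using kl(1) mod_eq_dvd_iff_nat[of k l m] by simp
      then show False
        using nat_dvd_not_less[of "l - k" m] kl \<open>j < i + m\<close> by (simp add: less_diff_conv2)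
    qed
  qed (rule linear)
  have symE: "(a, b) \<in> ?E" if "(b, a) \<in> ?E" for a b
    using sym_parcs that by (rule symD)
  have cover: "m \<le> Suc j - i" if "?V - {p} \<subseteq> c ` {i..j}" for i j
  proof -
    have "card (?V - {p}) \<le> card {i..j}"
      using that by (meson card_image_le card_mono finite_atLeastAtMost finite_imageI le_trans)
    then show ?thesis using \<open>card (?V - {p}) = m\<close> by simp
  qed
  \<comment> \<open>The edge closes the segment from \<open>c i\<close> to \<open>c j\<close> into a
    cycle, which must use all \<open>m\<close> vertices. This leaves only the closing edge of the
    original cycle.\<close>
  have chord: "j = Suc i \<or> (i = 0 \<and> j = m - 1)" if "(c i, c j) \<in> ?E" "i < j" "j < m" for i j
  proof (rule ccontr)
    assume *: "\<not> ?thesis"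
    have "vertex_cycle ?E (c i) (map c [Suc i..<Suc j])"
    proof (rule vertex_cycle_map_upt)
      have inj: "inj_on c {i..j}" using that by (intro c_inj) simp
      then show "inj_on c {Suc i..j}" by (rule inj_on_subset) auto
      show "c i \<notin> c ` {Suc i..j}"
        using inj_on_image_mem_iff[OF inj, of i "{Suc i..j}"] that by auto
    qed (use * that c_edge symE[OF that(1)] in auto)
    from all[OF this] have "?V - {p} \<subseteq> insert (c i) (c ` {Suc i..j})"
      by (auto simp: atLeastLessThanSuc_atLeastAtMost simp del: upt_Suc)
    also have "insert (c i) (c ` {Suc i..j}) \<subseteq> c ` {i..j}" using that by auto
    finally show False using cover[of i j] * that by linarith
  qed
  \<comment> \<open>\<open>p\<close> is not among the vertices to be covered, so the segment alone
    must contain all \<open>m\<close>.\<close>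
  have pendant: "m \<le> Suc j - i" if "(p, c i) \<in> ?E" "(p, c j) \<in> ?E" "i < j" "j < i + m" for i j
  proof -
    have "vertex_cycle ?E p (map c [i..<Suc j])"
    proof (rule vertex_cycle_map_upt)
      show "p \<notin> c ` {i..j}" using c_ne_p by (metis imageE)
    qed (use that c_edge symE[OF that(2)] c_inj in auto)
    from all[OF this] show ?thesis
      by (intro cover) (auto simp: atLeastLessThanSuc_atLeastAtMost simp del: upt_Suc)
  qed
  have pc: "i = 0" if "(p, c i) \<in> ?E" "i < m" for i
  proof (rule ccontr)
    assume "i \<noteq> 0"
    have p0: "(p, c 0) \<in> ?E" "(p, c m) \<in> ?E"
      using symE[OF w(2)] cs(4) by (auto simp: c_def)
    \<comment> \<open>The two paths of the cycle between \<open>c 0\<close> and \<open>c i\<close> cannot both cover it.\<close>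
    have "m \<le> Suc i - 0" "m \<le> Suc m - i"
      using pendant[of 0 i] pendant[of i m] p0 that \<open>i \<noteq> 0\<close> by auto
    then show False using cs(3) that by linarith
  qed
  have cc: "(c i, c j) \<in> ?E \<longleftrightarrow> j = Suc i mod m \<or> i = Suc j mod m" if "i < m" "j < m" for i j
  proof
    assume E: "(c i, c j) \<in> ?E"
    then have "i \<noteq> j" using irrefl_parcs by auto
    then consider "i < j" | "j < i" by linarith
    then show "j = Suc i mod m \<or> i = Suc j mod m"
    proof cases
      case 1
      then show ?thesis using chord[OF E] that cs(3) by auto
    next
      case 2
      then show ?thesis using chord[OF symE[OF E]] that cs(3) by auto
    qed
  next
    have "c (Suc k mod m) = c (Suc k)" for k by (simp add: c_def)
    then show "(c i, c j) \<in> ?E" if "j = Suc i mod m \<or> i = Suc j mod m"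
      using that c_edge symE by metis
  qed
  \<comment> \<open>This follows the model: \<open>0, ..., m - 1\<close> is the cycle and
    \<open>m\<close> the pendant vertex.\<close>
  define g where "g i = (if i < m then c i else p)" for i
  have "g ` {..<m} = (!) cs ` {..<m}"
    by (intro image_cong) (simp_all add: g_def c_def)
  also have "\<dots> = ?V - {p}"
    unfolding cs(2)[symmetric] set_conv_nth m_def by auto
  finally have "g ` insert m {..<m} = ?V"
    using p by (auto simp: g_def)
  moreover have "insert m {..<m} = {..m}" by auto
  ultimately have img: "g ` {..m} = ?V" by (simp only:)
  \<comment> \<open>Both sets have \<open>m + 1\<close> elements, so surjectivity gives
    injectivity.\<close>
  then have bij: "bij_betw g {..m} ?V"
    using mV p pair_finite_verts card_gt_0_iff[of ?V]
    by (intro eq_card_imp_inj_on bij_betw_imageI) auto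
  interpret H: pair_graph "cycle_pendant_graph m"
    using cs(3) by (intro pair_graph_cycle_pendant_graph) simp
  have "(g i, g j) \<in> ?E \<longleftrightarrow> (i, j) \<in> parcs (cycle_pendant_graph m)"
    if ij: "i \<le> m" "j \<le> m" for i j
  proof -
    have pk: "(p, c k) \<in> ?E \<longleftrightarrow> k = 0" "(c k, p) \<in> ?E \<longleftrightarrow> k = 0" if "k < m" for k
      using pc[OF _ that] pc[OF symE that] w(2) symE[OF w(2)] cs(3,4) by (auto simp: c_def)
    have "2 \<le> m" using cs(3) by simp
    note H = parcs_cycle_pendant_graph_iff[OF ij this]
    consider "i < m" "j < m" | "i < m" "j = m" | "i = m" "j < m" | "i = m" "j = m"
      using ij by linarith
    then show ?thesis
    proof cases
      case 1
      then show ?thesis unfolding H g_def using cc[OF 1] by simp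
    next
      case 2
      then show ?thesis unfolding H g_def using pk(2)[OF 2(1)] by simp
    next
      case 3
      then show ?thesis unfolding H g_def using pk(1)[OF 3(2)] by simp
    next
      case 4
      then show ?thesis unfolding H g_def using irrefl_parcs \<open>2 \<le> m\<close> by simp
    qed
  qed
  moreover have "pverts (cycle_pendant_graph m) = {..m}"
    by (simp add: cycle_pendant_graph_def)
  moreover have "pair_wf_digraph G" "pair_wf_digraph (cycle_pendant_graph m)" by unfold_locales
  ultimately have "digraph_iso (with_proj G) (with_proj (cycle_pendant_graph m))"
    using bij by (subst digraph_iso_with_proj_iff) auto
  then show ?thesis using cs(3) mV by (simp add: is_cycle_pendant_graph_def)
qed

text \<open>Vertex \<open>m\<close> has a single neighbour, hence lies on no cycle. The indices on a
  cycle are then closed under the cyclic successor, so they are all of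
  \<open>0, ..., m - 1\<close>.\<close>

lemma all_cycles_cover_if_cycle_pendant:
  assumes "is_cycle_pendant_graph m (with_proj G)"
  shows "\<exists>p\<in>pverts G. (\<forall>v xs. vertex_cycle (parcs G) v xs \<longrightarrow> pverts G - {p} \<subseteq> set (v # xs)) \<and>
      (\<exists>v xs. vertex_cycle (parcs G) v xs \<and> set (v # xs) = pverts G - {p})"
proof -
  let ?V = "pverts G" and ?E = "parcs G"
  have m: "3 \<le> m" and iso: "digraph_iso (with_proj G) (with_proj (cycle_pendant_graph m))"
    using assms by (auto simp: is_cycle_pendant_graph_def)
  interpret H: pair_graph "cycle_pendant_graph m"
    using m by (intro pair_graph_cycle_pendant_graph) simp
  have vH: "pverts (cycle_pendant_graph m) = {..m}"
    by (simp add: cycle_pendant_graph_def)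
  have "pair_wf_digraph G" "pair_wf_digraph (cycle_pendant_graph m)" by unfold_locales
  then obtain g where bij: "bij_betw g {..m} ?V"
      and iff': "\<And>i j. i \<le> m \<Longrightarrow> j \<le> m \<Longrightarrow> (g i, g j) \<in> ?E \<longleftrightarrow> (i, j) \<in> parcs (cycle_pendant_graph m)"
    using iso vH by (subst (asm) digraph_iso_with_proj_iff) auto
  have iff: "(g i, g j) \<in> ?E \<longleftrightarrow> (i < m \<and> j < m \<and> (j = Suc i mod m \<or> i = Suc j mod m))
      \<or> (i = 0 \<and> j = m) \<or> (i = m \<and> j = 0)" if "i \<le> m" "j \<le> m" for i j
    using parcs_cycle_pendant_graph_iff[of i m j] iff'[of i j] that m by simp
  have inj: "inj_on g {..m}" and img: "g ` {..m} = ?V"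
    using bij by (auto simp: bij_betw_def)
  have "{..m} = insert m {..<m}" by auto
  then have rest: "?V - {g m} = g ` {..<m}"
    using inj img by (auto simp: inj_on_def)
  have "?V - {g m} \<subseteq> set (v # xs)" if cyc: "vertex_cycle ?E v xs" for v xs
  proof -
    define X where "X = {i. i \<le> m \<and> g i \<in> set (v # xs)}"
    have nb: "\<exists>j k. j \<in> X \<and> k \<in> X \<and> j \<noteq> k \<and> (g i, g j) \<in> ?E \<and> (g i, g k) \<in> ?E" if "i \<in> X" for i
    proof -
      obtain y z where yz: "y \<in> set (v # xs)" "z \<in> set (v # xs)" "y \<noteq> z" "(g i, y) \<in> ?E" "(g i, z) \<in> ?E"
        using vertex_cycle_two_neighbours[OF cyc _ sym_parcs, of "g i"] \<open>i \<in> X\<close> by (auto simp: X_def)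
      then have "y \<in> g ` {..m}" "z \<in> g ` {..m}"
        using img in_arcsD2 by auto
      then obtain j k where "j \<le> m" "k \<le> m" "y = g j" "z = g k" by auto
      then show ?thesis using yz by (auto simp: X_def)
    qed
    have "m \<notin> X"
    proof
      assume "m \<in> X"
      then obtain j k where "j \<le> m" "k \<le> m" "j \<noteq> k" "(g m, g j) \<in> ?E" "(g m, g k) \<in> ?E"
        using nb[of m] unfolding X_def by blast
      then show False using iff[of m j] iff[of m k] m by auto
    qed
    \<comment> \<open>Of two distinct neighbours on the cycle at most one is the cyclic predecessor,
      so one is the successor.\<close>
    have step: "Suc i mod m \<in> X" if iX: "i \<in> X" for i
    proof -
      obtain j k where jk: "j \<in> X" "k \<in> X" "j \<noteq> k" "(g i, g j) \<in> ?E" "(g i, g k) \<in> ?E"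
        using nb[OF iX] by blast
      have lt: "i < m" "j < m" "k < m"
        using iX jk(1,2) \<open>m \<notin> X\<close> by (auto simp: X_def order_le_less)
      have "\<not> (i = Suc j mod m \<and> i = Suc k mod m)"
        using lt jk(3) by (auto simp: mod_Suc split: if_splits)
      then have "j = Suc i mod m \<or> k = Suc i mod m"
        using iff[of i j] iff[of i k] jk lt by auto
      then show ?thesis using jk by auto
    qed
    have "v \<in> g ` {..m}"
      using vertex_cycle_subset_pverts[OF cyc] img by auto
    then obtain i where "i \<in> X" by (auto simp: X_def)
    have "(i + k) mod m \<in> X" for k
    proof (induction k)
      case 0
      have "i < m" using \<open>i \<in> X\<close> \<open>m \<notin> X\<close> by (auto simp: X_def order_le_less)
      then show ?case using \<open>i \<in> X\<close> by simp
    next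
      case (Suc k)
      from step[OF this] show ?case by (simp add: mod_Suc_eq)
    qed
    \<comment> \<open>Since \<open>i + (m - i + k)\<close> is \<open>m + k\<close>, this shift
      reaches residue \<open>k\<close>.\<close>
    then have "(i + (m - i + k)) mod m \<in> X" for k .
    then have "k \<in> X" if "k < m" for k
      using that \<open>i \<in> X\<close> unfolding X_def by (metis (lifting) add.assoc le_add_diff_inverse
        mem_Collect_eq mod_add_self1 mod_less)
    then show ?thesis unfolding rest by (auto simp: X_def)
  qed
  moreover have "vertex_cycle ?E (g 0) (map g [1..<Suc (m - 1)])"
  proof (rule vertex_cycle_map_upt)
    show "inj_on g {1..m - 1}" by (rule inj_on_subset[OF inj]) auto
    show "g 0 \<notin> g ` {1..m - 1}" using inj_on_image_mem_iff[OF inj, of 0 "{1..m - 1}"] by auto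
  qed (use m iff in auto)
  moreover have "set (g 0 # map g [1..<Suc (m - 1)]) = ?V - {g m}"
  proof -
    have "{..<m} = insert 0 {1..<m}" using m by auto
    then show ?thesis unfolding rest using m by simp
  qed
  moreover have "g m \<in> ?V" using img by auto
  ultimately show ?thesis by blast
qed

section \<open>Order three and the conclusion\<close>

text \<open>If \<open>u\<close> and \<open>w\<close> are not adjacent, connectedness makes the third
  vertex \<open>v\<close> a neighbour of both, the middle of a path.\<close>

lemma order_three_complete_or_path:
  assumes "connected (with_proj G)" "card (pverts G) = 3"
  shows "complete_digraph 3 (with_proj G) \<or> is_path_graph 3 (with_proj G)"
proof (cases "\<forall>u\<in>pverts G. \<forall>v\<in>pverts G. u \<noteq> v \<longrightarrow> (u, v) \<in> parcs G")
  case True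
  have "graph (with_proj G)" by unfold_locales
  moreover have "parcs G = {(u, v). (u, v) \<in> pverts G \<times> pverts G \<and> u \<noteq> v}"
    using True by (auto simp: irrefl_parcs dest: in_arcsD1 in_arcsD2)
  ultimately show ?thesis using assms(2) by (simp add: complete_digraph_def)
next
  case False
  then obtain u w where uw: "u \<in> pverts G" "w \<in> pverts G" "u \<noteq> w" "(u, w) \<notin> parcs G" by blast
  have "card (pverts G - {u, w}) = 1"
    using uw assms(2) by (simp add: card_Diff_subset)
  then obtain v where v: "pverts G - {u, w} = {v}" by (auto simp: card_1_singleton_iff)
  then have V: "pverts G = {u, v, w}" "v \<noteq> u" "v \<noteq> w" using uw by auto
  have nwu: "(w, u) \<notin> parcs G" using uw(4) sym_parcs by (meson symD)
  have "(u, v) \<in> parcs G"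
    using connected_cut_arc[OF assms(1), of "{u}" u v] V uw by auto
  moreover have "(w, v) \<in> parcs G"
    using connected_cut_arc[OF assms(1), of "{w}" w v] V nwu by auto
  ultimately have edges: "(u, v) \<in> parcs G" "(v, u) \<in> parcs G" "(v, w) \<in> parcs G" "(w, v) \<in> parcs G"
    using sym_parcs by (auto dest: symD)
  define g where "g i = (if i = 0 then u else if i = 1 then v else w)" for i :: nat
  have P: "pverts (path_graph 3) = {0, 1, 2}"
    by (auto simp: path_graph_def)
  have A: "(i, j) \<in> parcs (path_graph 3) \<longleftrightarrow> (i = Suc j \<or> j = Suc i) \<and> i < 3 \<and> j < 3" for i j
    by (auto simp: path_graph_def symcl_def)
  interpret H: pair_graph "path_graph 3" by (rule pair_graph_path_graph)
  have "pair_wf_digraph G" "pair_wf_digraph (path_graph 3)" by unfold_locales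
  moreover have "bij_betw g (pverts (path_graph 3)) (pverts G)"
    unfolding P V(1) g_def using V uw by (auto simp: bij_betw_def inj_on_def)
  moreover have "\<forall>i\<in>{0, 1, 2}. \<forall>j\<in>{0, 1, 2}. (g i, g j) \<in> parcs G \<longleftrightarrow> (i, j) \<in> parcs (path_graph 3)"
    unfolding A g_def using edges irrefl_parcs uw(4) nwu by simp
  ultimately have "digraph_iso (with_proj G) (with_proj (path_graph 3))"
    unfolding P by (subst digraph_iso_with_proj_iff) (auto simp: P)
  then show ?thesis by (simp add: is_path_graph_def)
qed

end

lemma card_pverts_path_graph:
  assumes "pair_graph G" "is_path_graph k (with_proj G)"
  shows "card (pverts G) = k"
proof -
  interpret G: pair_graph G by fact
  interpret H: pair_graph "path_graph k" by (rule pair_graph_path_graph)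
  have "pair_wf_digraph G" "pair_wf_digraph (path_graph k)" by unfold_locales
  with assms(2) obtain g where "bij_betw g (pverts (path_graph k)) (pverts G)"
    by (auto simp: is_path_graph_def digraph_iso_with_proj_iff)
  then have "card (pverts (path_graph k)) = card (pverts G)" by (rule bij_betw_same_card)
  then show ?thesis by (simp add: path_graph_def)
qed

theorem theorem2:
  fixes G :: "'a pair_pre_digraph" and n :: nat
  assumes "pair_graph G"
    and "connected (with_proj G)"
    and "card (pverts G) = n"
    and "n \<ge> 3"
  shows "exchange_number (with_proj G) = n - 1 \<longleftrightarrow>
    complete_digraph 3 (with_proj G)
    \<or> is_path_graph 3 (with_proj G)
    \<or> is_cycle_pendant_graph (n - 1) (with_proj G)"
proof -
  interpret pair_graph G by fact
  have exch: "exchange_number (with_proj G) = n - 1 \<longleftrightarrow>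
      (\<exists>S. E_independent (with_proj G) S \<and> card S = n - 1)"
    using exchange_number_eq_iff assms(3,4) by simp
  show ?thesis
  \<comment> \<open>In order three both sides always hold, as any pair is E-independent. From order
    four on, counting vertices excludes the first two graphs.\<close>
  proof (cases "n = 3")
    case True
    obtain S where "S \<subseteq> pverts G" "card S = 2"
      using obtain_subset_with_card_n[of 2 "pverts G"] assms(3,4) by auto
    then obtain x y where "x \<in> pverts G" "y \<in> pverts G" "x \<noteq> y"
      by (auto simp: card_2_iff)
    then have "E_independent (with_proj G) {x, y}" "card {x, y} = 2"
      using E_independent_pair by auto
    then have "exchange_number (with_proj G) = n - 1"
      using exch True by auto
    then show ?thesis using order_three_complete_or_path assms(2,3) True by blast
  next
    case False
    then have n: "4 \<le> card (pverts G)" using assms(3,4) by simp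
    then have "\<not> complete_digraph 3 (with_proj G)" "\<not> is_path_graph 3 (with_proj G)"
      using card_pverts_path_graph[OF assms(1)] by (auto simp: complete_digraph_def)
    moreover have "exchange_number (with_proj G) = n - 1 \<longleftrightarrow>
        is_cycle_pendant_graph (n - 1) (with_proj G)"
      using exch E_independent_card_pred_iff[OF n] assms(3)
        cycle_pendant_if_all_cycles_cover[OF assms(2)] all_cycles_cover_if_cycle_pendant
      by metis
    ultimately show ?thesis by blast
  qed
qed

end
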